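(* Consider an ISAC system with $K$ communication users who do not cancel the interference from the sensing beams, with sensing performance measured by a $d$-quadratic metric $h_d$, and suppose that $K\ge\frac d2$. Let $\tilde{\mathcal{A}}^{\mathrm{NIC}}=\{(h_d(\mathbf{V}),\mathrm{vSINR}^{\mathrm{NIC}}_{\mathbf{V}}):\mathbf{V}\in\mathbb{C}^{N_T\times(N_T+K)},\ \mathrm{tr}(\mathbf{V}\mathbf{V}^{H})\le P\}$. Then for every $(h,\boldsymbol{\gamma})\in\tilde{\mathcal{A}}^{\mathrm{NIC}}$ with $\boldsymbol{\gamma}>\mathbf{0}$ (entrywise) there exists $\mathbf{V}'\in\mathbb{C}^{N_T\times K}$ (exactly $K$ beamformers, no sensing beamformers) such that $h_d(\mathbf{V}')=h$, $\mathrm{vSINR}^{\mathrm{NIC}}_{\mathbf{V}'}\ge\boldsymbol{\gamma}$ (entrywise) and $\mathrm{tr}(\mathbf{V}'\mathbf{V}'^{H})\le P$.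
   Context: Integers $N_T,d\ge1$, $K\ge0$; reals $\sigma^2>0$, $P>0$; fixed channel vectors $\mathbf{h}_1,\dots,\mathbf{h}_K\in\mathbb{C}^{N_T}$. Beamformers: for $N\ge K$, a beamforming matrix with $N$ beamformers is $\mathbf{V}=[\mathbf{v}_1,\dots,\mathbf{v}_K,\mathbf{V}_s]\in\mathbb{C}^{N_T\times N}$, with communication beamformers $\mathbf{v}_k\in\mathbb{C}^{N_T}$ and sensing beamformers $\mathbf{V}_s\in\mathbb{C}^{N_T\times(N-K)}$ (absent if $N=K$). $d$-quadratic: a real function $h_d$ of beamforming matrices $\mathbf{V}\in\mathbb{C}^{N_T\times N}$ (defined by the same formula for every $N$) is $d$-quadratic if $h_d(\mathbf{V})=f(\mathrm{tr}(\mathbf{Q}_1\mathbf{V}\mathbf{V}^{H}),\dots,\mathrm{tr}(\mathbf{Q}_d\mathbf{V}\mathbf{V}^{H}))$ for some linearly independent Hermitian matrices $\mathbf{Q}_1,\dots,\mathbf{Q}_d\in\mathbb{C}^{N_T\times N_T}$ and some function $f:\mathbb{R}^d\to\mathbb{R}$. SINR without interference cancellation (NIC): $\mathrm{SINR}^{\mathrm{NIC}}_{k,\mathbf{V}}=\dfrac{|\mathbf{h}_k^{H}\mathbf{v}_k|^2}{\sum_{i\ne k}|\mathbf{h}_k^{H}\mathbf{v}_i|^2+\mathbf{h}_k^{H}\mathbf{V}_s\mathbf{V}_s^{H}\mathbf{h}_k+\sigma^2}$, and $\mathrm{vSINR}^{\mathrm{NIC}}_{\mathbf{V}}=(\mathrm{SINR}^{\mathrm{NIC}}_{1,\mathbf{V}},\dots,\mathrm{SINR}^{\mathrm{NIC}}_{K,\mathbf{V}})^{T}$.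 *)

theory Defs
  imports "Jordan_Normal_Form.Schur_Decomposition" "Jordan_Normal_Form.VS_Connect"
begin

text \<open>
  Users, beamformers and the entries of tuples are indexed from 0. A beamforming matrix with
  \<open>N \<ge> K\<close> beamformers is an element of \<open>carrier_mat NT N\<close>: its columns
  \<open>0, \<dots>, K - 1\<close> are the communication beamformers, the remaining \<open>N - K\<close> columns
  are the sensing beamformers.
\<close>

definition mat_trace :: "'a :: comm_monoid_add mat \<Rightarrow> 'a" where
  "mat_trace A = (\<Sum>i < dim_row A. A $$ (i, i))"

definition hermitian_mat :: "complex mat \<Rightarrow> bool" where
  "hermitian_mat A \<longleftrightarrow> mat_adjoint A = A"

text \<open>For \<open>K = dim_col V\<close> the result has no columns.\<close>

definition sensing_beams :: "nat \<Rightarrow> complex mat \<Rightarrow> complex mat" where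
  "sensing_beams K V = mat (dim_row V) (dim_col V - K) (\<lambda>(i, j). V $$ (i, K + j))"

text \<open>
  The function \<open>f\<close> only matters on \<open>carrier_vec d\<close>. The traces are real because the
  \<open>Q i\<close> are Hermitian, so taking \<open>Re\<close> loses nothing. Linear independence is
  that of the family \<open>(Q i)\<close> with \<open>i < d\<close>, which is why \<open>Q\<close> must be
  injective in addition to its image being independent; for Hermitian matrices, independence
  over the complex numbers and over the reals coincide.
\<close>

definition d_quadratic :: "nat \<Rightarrow> nat \<Rightarrow> nat \<Rightarrow> (complex mat \<Rightarrow> real) \<Rightarrow> bool" where
  "d_quadratic NT K d h_d \<longleftrightarrow>
     (\<exists>(Q :: nat \<Rightarrow> complex mat) (f :: real vec \<Rightarrow> real).
        (\<forall>i < d. Q i \<in> carrier_mat NT NT \<and> hermitian_mat (Q i)) \<and>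
        inj_on Q {..<d} \<and>
        \<not> module.lin_dep class_ring (module_mat TYPE(complex) NT NT) (Q ` {..<d}) \<and>
        (\<forall>N \<ge> K. \<forall>V \<in> carrier_mat NT N.
           h_d V = f (vec d (\<lambda>i. Re (mat_trace (Q i * (V * mat_adjoint V)))))))"

text \<open>
  Since \<open>v \<bullet>c w\<close> conjugates its second argument, \<open>v \<bullet>c w\<close> is
  \<open>w\<^sup>H v\<close>.
\<close>

definition SINR_NIC :: "nat \<Rightarrow> real \<Rightarrow> (nat \<Rightarrow> complex vec) \<Rightarrow> complex mat \<Rightarrow> nat \<Rightarrow> real" where
  "SINR_NIC K \<sigma>2 hc V k =
     (cmod (col V k \<bullet>c hc k))\<^sup>2 /
     ((\<Sum>i \<in> {..<K} - {k}. (cmod (col V i \<bullet>c hc k))\<^sup>2)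
      + Re (((sensing_beams K V * mat_adjoint (sensing_beams K V)) *\<^sub>v hc k) \<bullet>c hc k)
      + \<sigma>2)"

definition vSINR_NIC :: "nat \<Rightarrow> real \<Rightarrow> (nat \<Rightarrow> complex vec) \<Rightarrow> complex mat \<Rightarrow> real vec" where
  "vSINR_NIC K \<sigma>2 hc V = vec K (SINR_NIC K \<sigma>2 hc V)"

definition A_NIC ::
  "nat \<Rightarrow> nat \<Rightarrow> real \<Rightarrow> real \<Rightarrow> (nat \<Rightarrow> complex vec) \<Rightarrow> (complex mat \<Rightarrow> real) \<Rightarrow> (real \<times> real vec) set"
where
  "A_NIC NT K \<sigma>2 P hc h_d =
     {(h_d V, vSINR_NIC K \<sigma>2 hc V) | V.
        V \<in> carrier_mat NT (NT + K) \<and> Re (mat_trace (V * mat_adjoint V)) \<le> P}"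

text \<open>
  The sensing term in the SINR is real: it is the total power of the sensing beams received
  by the user.
\<close>

lemma mat_adjoint_index:
  assumes "i < dim_col A" "j < dim_row A"
  shows "mat_adjoint (A :: complex mat) $$ (i, j) = cnj (A $$ (j, i))"
  using assms by (simp add: mat_adjoint_def mat_of_rows_def)

lemma mat_adjoint_carrier:
  "A \<in> carrier_mat m n \<Longrightarrow> mat_adjoint (A :: complex mat) \<in> carrier_mat n m"
  by (auto simp: mat_adjoint_def mat_of_rows_def)

lemma sensing_quadratic_form:
  assumes V: "V \<in> carrier_mat NT N" and h: "h \<in> carrier_vec NT" and "K \<le> N"
  shows "((sensing_beams K V * mat_adjoint (sensing_beams K V)) *\<^sub>v h) \<bullet>c h
         = of_real (\<Sum>i = K..<N. (cmod (col V i \<bullet>c h))\<^sup>2)"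
proof -
  let ?A = "sensing_beams K V"
  have A: "?A \<in> carrier_mat NT (N - K)" using V by (auto simp: sensing_beams_def)
  have A': "mat_adjoint ?A \<in> carrier_mat (N - K) NT" by (rule mat_adjoint_carrier[OF A])
  define w where "w = mat_adjoint ?A *\<^sub>v h"
  have w: "w \<in> carrier_vec (N - K)" using A' h by (simp add: w_def)
  have colA: "col ?A j = col V (K + j)" if "j < N - K" for j
    using that V by (intro eq_vecI) (auto simp: sensing_beams_def)
  have w_index: "w $ j = cnj (col V (K + j) \<bullet>c h)" if j: "j < N - K" for j
  proof -
    have "w $ j = (\<Sum>i = 0..<NT. cnj (?A $$ (i, j)) * h $ i)"
      using j A A' h by (simp add: w_def scalar_prod_def mat_adjoint_index)
    also have "\<dots> = cnj (col ?A j \<bullet>c h)"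
      using j A h by (simp add: scalar_prod_def)
    finally show ?thesis by (simp add: colA j)
  qed
  have "((?A * mat_adjoint ?A) *\<^sub>v h) \<bullet>c h = (?A *\<^sub>v w) \<bullet>c h"
    using A A' h by (simp add: w_def)
  also have "\<dots> = (\<Sum>i = 0..<NT. (\<Sum>j = 0..<N - K. ?A $$ (i, j) * w $ j) * cnj (h $ i))"
    using A w h by (simp add: scalar_prod_def)
  also have "\<dots> = (\<Sum>j = 0..<N - K. w $ j * (\<Sum>i = 0..<NT. ?A $$ (i, j) * cnj (h $ i)))"
    by (simp add: sum_distrib_left sum_distrib_right sum.swap[of _ "{0..<NT}"] mult_ac)
  also have "\<dots> = (\<Sum>j = 0..<N - K. w $ j * (col ?A j \<bullet>c h))"
    using A h by (intro sum.cong refl) (simp add: scalar_prod_def)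
  also have "\<dots> = (\<Sum>j = 0..<N - K. of_real ((cmod (col V (K + j) \<bullet>c h))\<^sup>2))"
    by (intro sum.cong refl) (simp add: w_index colA complex_norm_square mult.commute del: of_real_power)
  also have "\<dots> = of_real (\<Sum>i = K..<N. (cmod (col V i \<bullet>c h))\<^sup>2)"
    using \<open>K \<le> N\<close> sum.shift_bounds_nat_ivl[of "\<lambda>i. (cmod (col V i \<bullet>c h))\<^sup>2" 0 K "N - K"]
    by (simp add: add.commute)
  finally show ?thesis .
qed

end

theory Submission
  imports Defs "HOL-Analysis.Function_Topology"
begin

text \<open>
  Among all beamforming matrices with the same covariance as \<open>V\<close> and no weaker useful signals,
  one maximising the total useful signal amplitude has every sensing beam orthogonal to every
  channel: otherwise rotating a communication beam \<open>v\<^sub>k\<close> against a sensing beam seen by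
  user \<open>k\<close> would strengthen the signal of user \<open>k\<close> and leave the other signals alone.
  A sensing beam \<open>s\<close> orthogonal to all channels can be absorbed: replacing \<open>v\<^sub>j\<close> by
  \<open>v\<^sub>j + t c\<^sub>j s\<close> and dropping \<open>s\<close> changes the covariance by
  \<open>t (\<Sum>\<^sub>j c\<^sub>j s v\<^sub>j\<^sup>H + h.c.) + (t\<^sup>2 |c|\<^sup>2 - 1) s s\<^sup>H\<close>. If
  \<open>t\<^sup>2 |c|\<^sup>2 - 1 = t z\<close>, this is \<open>t\<close> times a linear function of the \<open>2 K + 1\<close>
  real unknowns \<open>(c, z)\<close>, on which the metric imposes only \<open>d \<le> 2 K\<close> linear equations. The
  quadratic equation for \<open>t\<close> has roots of both signs, so the power can be kept from growing.
\<close>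

section \<open>Hermitian products and quadratic forms of beams\<close>

text \<open>Vectors are functions of which only the coordinates below \<open>n\<close> count, so
  that beams can be changed pointwise and families of beams live in a product space. The second
  argument is conjugated, as in \<open>\<bullet>c\<close>.\<close>

definition herm_inner :: "nat \<Rightarrow> (nat \<Rightarrow> complex) \<Rightarrow> (nat \<Rightarrow> complex) \<Rightarrow> complex" where
  "herm_inner n x y = (\<Sum>a<n. x a * cnj (y a))"

text \<open>This is \<open>y\<^sup>H Q x\<close>.\<close>

definition sesq :: "nat \<Rightarrow> (nat \<Rightarrow> nat \<Rightarrow> complex) \<Rightarrow> (nat \<Rightarrow> complex) \<Rightarrow> (nat \<Rightarrow> complex) \<Rightarrow> complex" where
  "sesq n Q x y = (\<Sum>a<n. \<Sum>b<n. Q a b * x b * cnj (y a))"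

lemma herm_inner_lincomb:
  "herm_inner n (\<lambda>a. c * x a + d * y a) z = c * herm_inner n x z + d * herm_inner n y z"
  by (simp add: herm_inner_def algebra_simps sum.distrib sum_distrib_left)

lemma herm_inner_add_smult:
  "herm_inner n (\<lambda>a. x a + d * y a) z = herm_inner n x z + d * herm_inner n y z"
  using herm_inner_lincomb[of n 1 x d y z] by simp

lemma sesq_cnj:
  assumes "\<And>a b. a < n \<Longrightarrow> b < n \<Longrightarrow> Q b a = cnj (Q a b)"
  shows "sesq n Q y x = cnj (sesq n Q x y)"
proof -
  have "cnj (Q a b) = Q b a" if "a < n" "b < n" for a b
    using assms[OF that] by (rule sym)
  then have "cnj (sesq n Q x y) = (\<Sum>a<n. \<Sum>b<n. Q b a * cnj (x b) * y a)"
    unfolding sesq_def cnj_sum by (intro sum.cong refl) simp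
  also have "\<dots> = sesq n Q y x"
    unfolding sesq_def by (subst sum.swap) (simp add: mult_ac)
  finally show ?thesis by simp
qed

text \<open>The two cross terms are conjugate to each other because \<open>Q\<close> is Hermitian,
  so together they give twice a real part.\<close>

lemma Re_sesq_add_smult:
  assumes "\<And>a b. a < n \<Longrightarrow> b < n \<Longrightarrow> Q b a = cnj (Q a b)"
  shows "Re (sesq n Q (\<lambda>a. x a + c * y a) (\<lambda>a. x a + c * y a)) =
         Re (sesq n Q x x) + 2 * Re (c * sesq n Q y x) + (cmod c)\<^sup>2 * Re (sesq n Q y y)"
proof -
  have "sesq n Q (\<lambda>a. x a + c * y a) (\<lambda>a. x a + c * y a) =
        sesq n Q x x + c * sesq n Q y x + cnj c * sesq n Q x y + c * cnj c * sesq n Q y y"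
    by (simp add: sesq_def algebra_simps sum.distrib sum_distrib_left)
  moreover have "Re (cnj c * sesq n Q x y) = Re (c * sesq n Q y x)"
    by (simp add: sesq_cnj[where n = n and Q = Q and x = y and y = x, OF assms])
  moreover have "Re (c * cnj c * sesq n Q y y) = (cmod c)\<^sup>2 * Re (sesq n Q y y)"
    by (simp flip: complex_norm_square)
  ultimately show ?thesis by simp
qed

text \<open>The total sees the beams only through their covariance, so families with equal
  covariance agree under every quadratic form.\<close>

lemma sum_sesq_gram:
  "(\<Sum>j<N. sesq n Q (w j) (w j)) = (\<Sum>a<n. \<Sum>b<n. Q a b * (\<Sum>j<N. w j b * cnj (w j a)))"
proof -
  have "(\<Sum>j<N. sesq n Q (w j) (w j)) = (\<Sum>a<n. \<Sum>j<N. \<Sum>b<n. Q a b * w j b * cnj (w j a))"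
    unfolding sesq_def by (rule sum.swap)
  also have "\<dots> = (\<Sum>a<n. \<Sum>b<n. \<Sum>j<N. Q a b * w j b * cnj (w j a))"
    by (intro sum.cong refl sum.swap)
  finally show ?thesis by (simp add: sum_distrib_left mult.assoc)
qed

text \<open>The power received over the channel \<open>h\<close> is the quadratic form of the
  rank-one matrix \<open>h h\<^sup>H\<close>; hence the total received power is determined by the
  covariance.\<close>

lemma sum_norm_herm_inner_gram:
  "of_real (\<Sum>j<N. (cmod (herm_inner n (w j) h))\<^sup>2) =
     (\<Sum>a<n. \<Sum>b<n. cnj (h b) * h a * (\<Sum>j<N. w j b * cnj (w j a)))"
proof -
  have "of_real ((cmod (herm_inner n x h))\<^sup>2) = sesq n (\<lambda>a b. cnj (h b) * h a) x x" for x
    unfolding complex_norm_square herm_inner_def sesq_def cnj_sum sum_product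
    by (subst sum.swap) (simp add: mult_ac)
  then show ?thesis by (simp only: of_real_sum sum_sesq_gram)
qed

section \<open>Linear systems and compactness\<close>

text \<open>Gaussian elimination, by induction on the number of equations: a pivot in the last
  equation removes one equation and one unknown, so the unknowns stay in the majority.\<close>

lemma homogeneous_system_nontrivial:
  fixes A :: "nat \<Rightarrow> 'j \<Rightarrow> 'a :: field"
  assumes "finite S" "d < card S"
  obtains x where "\<exists>j\<in>S. x j \<noteq> 0" "\<And>i. i < d \<Longrightarrow> (\<Sum>j\<in>S. A i j * x j) = 0"
proof -
  have "\<exists>x. (\<exists>j\<in>S. x j \<noteq> 0) \<and> (\<forall>i<d. (\<Sum>j\<in>S. A i j * x j) = 0)"
    using assms
  proof (induction d arbitrary: S A)
    case 0
    then have "S \<noteq> {}" by auto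
    then show ?case by (intro exI[of _ "\<lambda>_. 1"]) auto
  next
    case (Suc d)
    show ?case
    proof (cases "\<forall>j\<in>S. A d j = 0")
      case True
      obtain x where "\<exists>j\<in>S. x j \<noteq> 0" "\<forall>i<d. (\<Sum>j\<in>S. A i j * x j) = 0"
        using Suc.IH[of S A] Suc.prems by auto
      with True show ?thesis by (intro exI[of _ x]) (auto simp: less_Suc_eq)
    next
      case False
      then obtain p where p: "p \<in> S" "A d p \<noteq> 0" by auto
      \<comment> \<open>Row reduction with pivot \<open>A d p\<close>: row \<open>d\<close> and
        column \<open>p\<close> of \<open>B\<close> vanish.\<close>
      define B where "B i j = A i j - A i p * A d j / A d p" for i j
      obtain x where x: "\<exists>j\<in>S - {p}. x j \<noteq> 0" "\<forall>i<d. (\<Sum>j\<in>S - {p}. B i j * x j) = 0"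
        using Suc.IH[of "S - {p}" B] Suc.prems p by (auto simp: card_Diff_singleton less_diff_conv)
      \<comment> \<open>The coordinate at \<open>p\<close> is the one that solves equation
        \<open>d\<close> once the others are given by \<open>x\<close>.\<close>
      define y where "y = x(p := - (\<Sum>j\<in>S - {p}. A d j * x j) / A d p)"
      have sum_y: "(\<Sum>j\<in>S. A i j * y j) = (\<Sum>j\<in>S - {p}. B i j * x j)" for i
      proof -
        have "(\<Sum>j\<in>S. A i j * y j) = A i p * y p + (\<Sum>j\<in>S - {p}. A i j * y j)"
          using Suc.prems p by (simp add: sum.remove)
        also have "(\<Sum>j\<in>S - {p}. A i j * y j) = (\<Sum>j\<in>S - {p}. A i j * x j)"
          by (intro sum.cong) (auto simp: y_def)
        also have "A i p * y p = - (\<Sum>j\<in>S - {p}. A i p * A d j / A d p * x j)"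
          by (simp add: y_def sum_distrib_left sum_divide_distrib mult_ac)
        finally show ?thesis
          by (simp add: B_def left_diff_distrib sum_subtractf)
      qed
      have "B d j = 0" for j using p by (simp add: B_def)
      then have "\<forall>i<Suc d. (\<Sum>j\<in>S. A i j * y j) = 0"
        using x(2) by (auto simp: sum_y less_Suc_eq)
      moreover have "\<exists>j\<in>S. y j \<noteq> 0" using x(1) by (auto simp: y_def)
      ultimately show ?thesis by blast
    qed
  qed
  then show ?thesis using that by blast
qed

text \<open>Tychonoff's theorem, stated for function types with their product topology.\<close>

lemma compact_PiE_UNIV:
  fixes C :: "'i \<Rightarrow> 'a :: topological_space set"
  assumes "\<And>i. compact (C i)"
  shows "compact {x. \<forall>i. x i \<in> C i}"
proof -
  have "compactin (product_topology (\<lambda>i. euclidean) UNIV) (PiE UNIV C)"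
    using assms by (simp add: compactin_PiE)
  moreover have "PiE UNIV C = {x. \<forall>i. x i \<in> C i}" by auto
  ultimately show ?thesis
    by (simp add: euclidean_product_topology)
qed

(* Importing the theory that provides compact_cball would hide the matrix library's type vec. *)
lemma compact_cmod_le: "compact {z. cmod z \<le> r}"
proof -
  have "continuous_on UNIV (\<lambda>p. Complex (fst p) (snd p))"
    unfolding complex_eq by (intro continuous_intros)
  then have "compact ((\<lambda>p. Complex (fst p) (snd p)) ` ({- r..r} \<times> {- r..r}))"
    by (intro compact_continuous_image compact_Times compact_Icc) (auto intro: continuous_on_subset)
  moreover have "{z. cmod z \<le> r} \<subseteq> (\<lambda>p. Complex (fst p) (snd p)) ` ({- r..r} \<times> {- r..r})"
  proof
    fix z :: complex assume "z \<in> {z. cmod z \<le> r}"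
    then have "\<bar>Re z\<bar> \<le> r" "\<bar>Im z\<bar> \<le> r"
      using abs_Re_le_cmod[of z] abs_Im_le_cmod[of z] by auto
    then show "z \<in> (\<lambda>p. Complex (fst p) (snd p)) ` ({- r..r} \<times> {- r..r})"
      by (intro image_eqI[of _ _ "(Re z, Im z)"]) auto
  qed
  moreover have "closed {z. cmod z \<le> r}"
    by (intro closed_Collect_le continuous_intros)
  ultimately show ?thesis
    by (metis compact_Int_closed inf.absorb_iff2)
qed

section \<open>Making the sensing beams orthogonal to the channels\<close>

text \<open>The pair \<open>(x, y)\<close> is transformed by a unitary 2 by 2 matrix, which leaves
  its covariance unchanged.\<close>

lemma rotate_pair_gram:
  fixes x y :: "nat \<Rightarrow> complex"
  assumes "\<alpha> * cnj \<alpha> + \<beta> * cnj \<beta> = 1"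
  shows "(cnj \<alpha> * x a + cnj \<beta> * y a) * cnj (cnj \<alpha> * x b + cnj \<beta> * y b)
       + (\<beta> * x a + (- \<alpha>) * y a) * cnj (\<beta> * x b + (- \<alpha>) * y b)
       = x a * cnj (x b) + y a * cnj (y b)" (is "?l = ?r")
proof -
  have "?l = (\<alpha> * cnj \<alpha> + \<beta> * cnj \<beta>) * ?r"
    by (simp add: algebra_simps)
  with assms show ?thesis by simp
qed

text \<open>The maximiser exists by compactness: fixing the covariance bounds every coordinate, and
  the constraints on covariance and signals are closed.\<close>

lemma align_beams:
  fixes v h :: "nat \<Rightarrow> nat \<Rightarrow> complex"
  assumes "K \<le> N"
  obtains w where
    "\<And>a b. (\<Sum>j<N. w j a * cnj (w j b)) = (\<Sum>j<N. v j a * cnj (v j b))"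
    "\<And>k. k < K \<Longrightarrow> cmod (herm_inner n (v k) (h k)) \<le> cmod (herm_inner n (w k) (h k))"
    "\<And>k s. k < K \<Longrightarrow> K \<le> s \<Longrightarrow> s < N \<Longrightarrow> herm_inner n (w s) (h k) = 0"
proof -
  let ?sig = "\<lambda>u k. cmod (herm_inner n (\<lambda>a. u (k, a)) (h k))"
  define G where "G a b = (\<Sum>j<N. v j a * cnj (v j b))" for a b
  \<comment> \<open>The bound comes from the diagonal of the covariance. Beams with index at least
    \<open>N\<close> are pinned to 0, so that every factor of the product over all index pairs is
    compact.\<close>
  define C where "C = (\<lambda>(j, a). if j < N then {z. cmod z \<le> sqrt (Re (G a a))} else {0})"
  define T where "T = {u. (\<forall>p. u p \<in> C p)} \<inter>
    ({u. \<forall>a b. (\<Sum>j<N. u (j, a) * cnj (u (j, b))) = G a b} \<inter>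
     {u. \<forall>k. k < K \<longrightarrow> cmod (herm_inner n (v k) (h k)) \<le> ?sig u k})"
  have coord [continuous_intros]: "continuous_on A (\<lambda>u. u p)" for A :: "(nat \<times> nat \<Rightarrow> complex) set" and p
    by (rule continuous_on_subset[OF continuous_on_product_coordinates]) simp
  have cont: "continuous_on A (\<lambda>u. ?sig u k)" for A k
    unfolding herm_inner_def by (intro continuous_intros)
  have "compact {u. \<forall>p. u p \<in> C p}"
    by (rule compact_PiE_UNIV) (auto simp: C_def compact_cmod_le)
  then have "compact T"
    unfolding T_def by (intro compact_Int_closed closed_Int closed_Collect_all closed_Collect_imp open_Collect_const
      closed_Collect_eq closed_Collect_le cont continuous_intros)
  \<comment> \<open>The coordinate bounds in \<open>C\<close> follow from the covariance, since each
    squared modulus is one summand of \<open>G a a\<close>.\<close>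
  have in_T: "u \<in> T" if gram: "\<And>a b. (\<Sum>j<N. u (j, a) * cnj (u (j, b))) = G a b"
      and out: "\<And>j a. \<not> j < N \<Longrightarrow> u (j, a) = 0"
      and sig: "\<And>k. k < K \<Longrightarrow> cmod (herm_inner n (v k) (h k)) \<le> ?sig u k" for u
  proof -
    have "cmod (u (j, a)) \<le> sqrt (Re (G a a))" if "j < N" for j a
    proof (rule real_le_rsqrt)
      have "(cmod (u (j, a)))\<^sup>2 \<le> (\<Sum>j<N. (cmod (u (j, a)))\<^sup>2)"
        using that by (intro member_le_sum) auto
      also have "\<dots> = Re (\<Sum>j<N. u (j, a) * cnj (u (j, a)))"
        by (simp flip: complex_norm_square)
      finally show "(cmod (u (j, a)))\<^sup>2 \<le> Re (G a a)" by (simp only: gram)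
    qed
    then show ?thesis using assms gram sig by (auto simp: T_def C_def out)
  qed
  have "(\<lambda>(j, a). if j < N then v j a else 0) \<in> T"
    using assms by (intro in_T) (auto simp: G_def intro!: sum.cong)
  then have "T \<noteq> {}" by auto
  moreover have "continuous_on T (\<lambda>u. \<Sum>k<K. ?sig u k)"
    by (intro continuous_on_sum cont)
  ultimately obtain u where u: "u \<in> T" and
    max: "\<And>u'. u' \<in> T \<Longrightarrow> (\<Sum>k<K. ?sig u' k) \<le> (\<Sum>k<K. ?sig u k)"
    using continuous_attains_sup[OF \<open>compact T\<close>] by blast
  have gram: "(\<Sum>j<N. u (j, a) * cnj (u (j, b))) = G a b" for a b
    using u by (auto simp: T_def)
  have out: "u (j, a) = 0" if "\<not> j < N" for j a
    using u that unfolding T_def C_def by (auto split: if_splits dest!: spec[of _ "(j, a)"])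
  have sig: "cmod (herm_inner n (v k) (h k)) \<le> ?sig u k" if "k < K" for k
    using u that by (auto simp: T_def)
  have "herm_inner n (\<lambda>a. u (s, a)) (h k) = 0" if ks: "k < K" "K \<le> s" "s < N" for k s
  proof (rule ccontr)
    let ?x = "\<lambda>a. u (k, a)" and ?y = "\<lambda>a. u (s, a)"
    define \<alpha> where "\<alpha> = herm_inner n ?x (h k)"
    define \<beta> where "\<beta> = herm_inner n ?y (h k)"
    assume "herm_inner n (\<lambda>a. u (s, a)) (h k) \<noteq> 0"
    then have "\<beta> \<noteq> 0" by (simp add: \<beta>_def)
    define r where "r = sqrt ((cmod \<alpha>)\<^sup>2 + (cmod \<beta>)\<^sup>2)"
    have r_gt: "cmod \<alpha> < r"
      unfolding r_def using \<open>\<beta> \<noteq> 0\<close> by (intro real_less_rsqrt) simp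
    then have "r > 0" using norm_ge_zero[of \<alpha>] by linarith
    have r2: "\<alpha> * cnj \<alpha> + \<beta> * cnj \<beta> = of_real r * of_real r"
      by (simp add: r_def flip: complex_norm_square of_real_mult of_real_add of_real_power)
    \<comment> \<open>The coefficients are the Cauchy-Schwarz optimum: \<open>x'\<close> collects
      the whole amplitude \<open>r\<close> that both beams deliver to user \<open>k\<close>, and
      \<open>y'\<close> becomes orthogonal to \<open>h k\<close>.\<close>
    define x' where "x' a = cnj (\<alpha> / of_real r) * ?x a + cnj (\<beta> / of_real r) * ?y a" for a
    define y' where "y' a = (\<beta> / of_real r) * ?x a + (- (\<alpha> / of_real r)) * ?y a" for a
    have unit: "(\<alpha> / of_real r) * cnj (\<alpha> / of_real r) + (\<beta> / of_real r) * cnj (\<beta> / of_real r) = 1"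
      using r2 \<open>r > 0\<close> by (simp add: add_divide_distrib[symmetric])
    define u' where "u' = (\<lambda>(j, a). if j = k then x' a else if j = s then y' a else u (j, a))"
    have u'_k: "(\<lambda>a. u' (k, a)) = x'" by (simp add: u'_def)
    have u'_other: "(\<lambda>a. u' (j, a)) = (\<lambda>a. u (j, a))" if "j < K" "j \<noteq> k" for j
      using that ks by (simp add: u'_def)
    have "herm_inner n x' (h k) = cnj (\<alpha> / of_real r) * \<alpha> + cnj (\<beta> / of_real r) * \<beta>"
      unfolding x'_def herm_inner_lincomb by (simp add: \<alpha>_def \<beta>_def)
    also have "\<dots> = of_real r"
      using r2 \<open>r > 0\<close> by (simp add: add_divide_distrib[symmetric] mult.commute)
    finally have sig_k: "?sig u' k = r" using \<open>r > 0\<close> by (simp add: u'_k)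
    have "u' \<in> T"
    proof (rule in_T)
      fix a b
      have split: "(\<Sum>j<N. f j) = f k + f s + (\<Sum>j\<in>{..<N} - {k} - {s}. f j)" for f :: "nat \<Rightarrow> complex"
        using ks by (simp add: sum.remove[of _ k] sum.remove[of _ s] add.assoc)
      have "(\<Sum>j\<in>{..<N} - {k} - {s}. u' (j, a) * cnj (u' (j, b))) =
            (\<Sum>j\<in>{..<N} - {k} - {s}. u (j, a) * cnj (u (j, b)))"
        by (intro sum.cong) (auto simp: u'_def)
      moreover have "u' (k, a) * cnj (u' (k, b)) + u' (s, a) * cnj (u' (s, b)) =
                     u (k, a) * cnj (u (k, b)) + u (s, a) * cnj (u (s, b))"
        using ks rotate_pair_gram[OF unit, of ?x a ?y b] by (simp add: u'_def x'_def y'_def)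
      ultimately show "(\<Sum>j<N. u' (j, a) * cnj (u' (j, b))) = G a b"
        by (simp add: split flip: gram)
    next
      show "u' (j, a) = 0" if "\<not> j < N" for j a
        using that ks by (auto simp: u'_def out)
    next
      fix j assume "j < K"
      then show "cmod (herm_inner n (v j) (h j)) \<le> ?sig u' j"
        using sig[of j] r_gt sig_k u'_other[of j] by (cases "j = k") (auto simp: \<alpha>_def)
    qed
    moreover have "(\<Sum>j<K. ?sig u j) < (\<Sum>j<K. ?sig u' j)"
    proof (rule sum_strict_mono_ex1)
      show "\<forall>j\<in>{..<K}. ?sig u j \<le> ?sig u' j"
        using r_gt sig_k u'_other by (metis \<alpha>_def lessThan_iff less_eq_real_def)
      show "\<exists>j\<in>{..<K}. ?sig u j < ?sig u' j"
        using r_gt sig_k ks(1) by (auto simp: \<alpha>_def)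
    qed simp
    ultimately show False using max by fastforce
  qed
  then show ?thesis
    using that[of "\<lambda>j a. u (j, a)"] gram sig by (simp add: G_def)
qed

section \<open>Absorbing invisible sensing beams\<close>

text \<open>The two real roots of the quadratic have product \<open>- 1 / A < 0\<close>, so one of
  them has the sign that makes \<open>t * l\<close> nonpositive.\<close>

lemma quadratic_root_sign:
  fixes A z l :: real
  assumes "A > 0"
  obtains t where "t\<^sup>2 * A = 1 + t * z" "t * l \<le> 0"
proof -
  define D where "D = sqrt (z\<^sup>2 + 4 * A)"
  have D2: "D\<^sup>2 = z\<^sup>2 + 4 * A" using assms by (simp add: D_def)
  have "\<bar>z\<bar> \<le> D" unfolding D_def using assms by (intro real_le_rsqrt) simp
  have "((z + D) / (2 * A))\<^sup>2 * A = 1 + (z + D) / (2 * A) * z"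
       "((z - D) / (2 * A))\<^sup>2 * A = 1 + (z - D) / (2 * A) * z"
    using D2 assms by (auto simp: field_simps power2_eq_square)
  moreover have "(z + D) / (2 * A) \<ge> 0" "(z - D) / (2 * A) \<le> 0"
    using \<open>\<bar>z\<bar> \<le> D\<close> assms by (auto simp: divide_simps)
  moreover have "l \<le> 0 \<or> 0 \<le> l" by linarith
  ultimately show ?thesis
    using that mult_nonneg_nonpos mult_nonpos_nonneg by metis
qed

text \<open>The form \<open>Q d\<close> is not preserved but only kept from growing; it will be the transmit power.\<close>

lemma absorb_beam:
  fixes Q :: "nat \<Rightarrow> nat \<Rightarrow> nat \<Rightarrow> complex" and v :: "nat \<Rightarrow> nat \<Rightarrow> complex"
  assumes herm: "\<And>i a b. i \<le> d \<Longrightarrow> a < n \<Longrightarrow> b < n \<Longrightarrow> Q i b a = cnj (Q i a b)"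
    and "d \<le> 2 * K"
    and nonneg: "Re (sesq n (Q d) s s) \<ge> 0"
  obtains c where
    "\<And>i. i < d \<Longrightarrow> (\<Sum>j<K. Re (sesq n (Q i) (\<lambda>a. v j a + c j * s a) (\<lambda>a. v j a + c j * s a))) =
       (\<Sum>j<K. Re (sesq n (Q i) (v j) (v j))) + Re (sesq n (Q i) s s)"
    "(\<Sum>j<K. Re (sesq n (Q d) (\<lambda>a. v j a + c j * s a) (\<lambda>a. v j a + c j * s a))) \<le>
       (\<Sum>j<K. Re (sesq n (Q d) (v j) (v j))) + Re (sesq n (Q d) s s)"
proof -
  let ?q = "\<lambda>i. Re (sesq n (Q i) s s)" and ?b = "\<lambda>i j. sesq n (Q i) s (v j)"
  \<comment> \<open>The columns stand for the \<open>2 K + 1\<close> real unknowns: the real parts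
    of \<open>c\<close>, then its imaginary parts, then \<open>z\<close>. The minus sign comes from
    \<open>Re (c * b) = Re c * Re b - Im c * Im b\<close>.\<close>
  define M where "M i j = (if j < K then 2 * Re (?b i j)
      else if j < K + K then - 2 * Im (?b i (j - K)) else ?q i)" for i j
  obtain x where x: "\<exists>j\<in>{..<Suc (K + K)}. x j \<noteq> 0"
      and sol: "\<And>i. i < d \<Longrightarrow> (\<Sum>j\<in>{..<Suc (K + K)}. M i j * x j) = 0"
    using homogeneous_system_nontrivial[of "{..<Suc (K + K)}" d M] \<open>d \<le> 2 * K\<close> by auto
  define c where "c j = Complex (x j) (x (K + j))" for j
  define z where "z = x (K + K)"
  define A where "A = (\<Sum>j<K. (cmod (c j))\<^sup>2)"
  define L where "L i = (\<Sum>j<K. 2 * Re (c j * ?b i j)) + z * ?q i" for i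
  have split: "(\<Sum>j<K + K. f j) = (\<Sum>j<K. f j) + (\<Sum>j<K. f (K + j))" for f :: "nat \<Rightarrow> real"
    using sum.atLeastLessThan_concat[of 0 K "K + K" f] sum.shift_bounds_nat_ivl[of f 0 K K]
    by (simp add: lessThan_atLeast0 add.commute)
  have L_eq: "L i = (\<Sum>j\<in>{..<Suc (K + K)}. M i j * x j)" for i
    by (simp add: split L_def M_def c_def z_def algebra_simps sum_subtractf sum_negf sum.distrib)
  \<comment> \<open>The terms quadratic in \<open>t\<close> add up to \<open>t\<^sup>2 * A\<close>
    times the form at \<open>s\<close>. Replacing this factor by \<open>1 + t * z\<close> yields the
    contribution of the dropped beam plus \<open>t\<close> times the linear function
    \<open>L i\<close>.\<close>
  have change: "(\<Sum>j<K. Re (sesq n (Q i) (\<lambda>a. v j a + (of_real t * c j) * s a)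
        (\<lambda>a. v j a + (of_real t * c j) * s a))) =
      (\<Sum>j<K. Re (sesq n (Q i) (v j) (v j))) + ?q i + t * L i"
    if "i \<le> d" "t\<^sup>2 * A = 1 + t * z" for i t
  proof -
    have summand: "Re (sesq n (Q i) (\<lambda>a. v j a + (of_real t * c j) * s a)
        (\<lambda>a. v j a + (of_real t * c j) * s a)) =
      Re (sesq n (Q i) (v j) (v j)) + t * (2 * Re (c j * ?b i j)) + t\<^sup>2 * (cmod (c j))\<^sup>2 * ?q i" for j
    proof -
      have herm_i: "Q i b a = cnj (Q i a b)" if "a < n" "b < n" for a b
        using herm[OF \<open>i \<le> d\<close> that] .
      have "Re (of_real t * c j * ?b i j) = t * Re (c j * ?b i j)"
        by (simp add: right_diff_distrib mult.assoc)
      moreover have "(cmod (of_real t * c j))\<^sup>2 = t\<^sup>2 * (cmod (c j))\<^sup>2"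
        by (simp add: norm_mult power_mult_distrib)
      ultimately show ?thesis
        using Re_sesq_add_smult[where n = n and Q = "Q i" and x = "v j" and c = "of_real t * c j" and y = s, OF herm_i]
        by (simp only: mult.left_commute)
    qed
    have "(\<Sum>j<K. Re (sesq n (Q i) (\<lambda>a. v j a + (of_real t * c j) * s a)
        (\<lambda>a. v j a + (of_real t * c j) * s a))) =
      (\<Sum>j<K. Re (sesq n (Q i) (v j) (v j)) + t * (2 * Re (c j * ?b i j))
         + t\<^sup>2 * (cmod (c j))\<^sup>2 * ?q i)"
      by (intro sum.cong refl summand)
    also have "\<dots> = (\<Sum>j<K. Re (sesq n (Q i) (v j) (v j)))
        + t * (\<Sum>j<K. 2 * Re (c j * ?b i j)) + t\<^sup>2 * A * ?q i"
      by (simp only: A_def sum.distrib sum_distrib_left sum_distrib_right)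
    also have "t\<^sup>2 * A * ?q i = ?q i + t * (z * ?q i)"
      unfolding that(2) by (simp add: algebra_simps)
    finally show ?thesis by (simp add: L_def algebra_simps)
  qed
  \<comment> \<open>For \<open>c = 0\<close> the beam \<open>s\<close> is simply dropped.\<close>
  have "\<exists>t. t\<^sup>2 * A = 1 + t * z \<and> t * L d \<le> 0"
  proof (cases "A = 0")
    case True
    then have c0: "c j = 0" if "j < K" for j
      using that by (auto simp: A_def sum_nonneg_eq_0_iff)
    have "z \<noteq> 0"
    proof
      assume "z = 0"
      have "x j = 0" if jK: "j < Suc (K + K)" for j
      proof -
        consider "j < K" | "K \<le> j" "j - K < K" | "j = K + K" using jK by arith
        then show ?thesis
          using c0[of j] c0[of "j - K"] \<open>z = 0\<close> by cases (auto simp: c_def z_def complex_eq_iff)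
      qed
      with x show False by auto
    qed
    \<comment> \<open>For \<open>t = - 1 / z\<close> the equation holds because
      \<open>A = 0\<close>, and \<open>t * L d\<close> is minus the nonnegative value of the form
      \<open>Q d\<close> at \<open>s\<close>.\<close>
    moreover have "L d = z * ?q d" using c0 by (simp add: L_def)
    ultimately show ?thesis
      using True nonneg by (intro exI[of _ "- 1 / z"]) auto
  next
    case False
    moreover have "A \<ge> 0" by (simp add: A_def sum_nonneg)
    ultimately have "A > 0" by simp
    then show ?thesis using quadratic_root_sign by metis
  qed
  then obtain t where t: "t\<^sup>2 * A = 1 + t * z" "t * L d \<le> 0" by blast
  have "L i = 0" if "i < d" for i using sol[OF that] by (simp only: L_eq)
  then show ?thesis
    using that[of "\<lambda>j. of_real t * c j"] change[OF _ t(1)] t(2) by simp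
qed

text \<open>Induction on \<open>N\<close>: beam \<open>N\<close> is absorbed into the
  \<open>K\<close> beams already obtained. The defects of form \<open>d\<close> only accumulate
  downwards, and since the absorbed beam is orthogonal to every \<open>h k\<close>, no received
  amplitude changes.\<close>

lemma absorb_beams:
  fixes Q :: "nat \<Rightarrow> nat \<Rightarrow> nat \<Rightarrow> complex" and v :: "nat \<Rightarrow> nat \<Rightarrow> complex"
  assumes herm: "\<And>i a b. i \<le> d \<Longrightarrow> a < n \<Longrightarrow> b < n \<Longrightarrow> Q i b a = cnj (Q i a b)"
    and "d \<le> 2 * K"
    and nonneg: "\<And>x. Re (sesq n (Q d) x x) \<ge> 0"
    and "K \<le> N"
    and orth: "\<And>k s. k < K \<Longrightarrow> K \<le> s \<Longrightarrow> s < N \<Longrightarrow> herm_inner n (v s) (h k) = 0"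
  shows "\<exists>w. (\<forall>i<d. (\<Sum>j<K. Re (sesq n (Q i) (w j) (w j))) = (\<Sum>j<N. Re (sesq n (Q i) (v j) (v j)))) \<and>
    (\<Sum>j<K. Re (sesq n (Q d) (w j) (w j))) \<le> (\<Sum>j<N. Re (sesq n (Q d) (v j) (v j))) \<and>
    (\<forall>j<K. \<forall>k<K. herm_inner n (w j) (h k) = herm_inner n (v j) (h k))"
  using \<open>K \<le> N\<close> orth
proof (induction N rule: dec_induct)
  case base
  show ?case by (intro exI[of _ v]) auto
next
  case (step N)
  have "\<And>k s. k < K \<Longrightarrow> K \<le> s \<Longrightarrow> s < N \<Longrightarrow> herm_inner n (v s) (h k) = 0"
    using step.prems less_SucI by blast
  from step.IH[OF this] obtain w where
    w: "\<And>i. i < d \<Longrightarrow> (\<Sum>j<K. Re (sesq n (Q i) (w j) (w j))) = (\<Sum>j<N. Re (sesq n (Q i) (v j) (v j)))"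
       "(\<Sum>j<K. Re (sesq n (Q d) (w j) (w j))) \<le> (\<Sum>j<N. Re (sesq n (Q d) (v j) (v j)))"
       "\<And>j k. j < K \<Longrightarrow> k < K \<Longrightarrow> herm_inner n (w j) (h k) = herm_inner n (v j) (h k)"
    by blast
  obtain c where
    "\<And>i. i < d \<Longrightarrow> (\<Sum>j<K. Re (sesq n (Q i) (\<lambda>a. w j a + c j * v N a) (\<lambda>a. w j a + c j * v N a))) =
       (\<Sum>j<K. Re (sesq n (Q i) (w j) (w j))) + Re (sesq n (Q i) (v N) (v N))"
    "(\<Sum>j<K. Re (sesq n (Q d) (\<lambda>a. w j a + c j * v N a) (\<lambda>a. w j a + c j * v N a))) \<le>
       (\<Sum>j<K. Re (sesq n (Q d) (w j) (w j))) + Re (sesq n (Q d) (v N) (v N))"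
    using absorb_beam[where n = n and d = d and Q = Q and K = K and s = "v N" and v = w,
      OF herm \<open>d \<le> 2 * K\<close> nonneg] by blast
  moreover have "herm_inner n (\<lambda>a. w j a + c j * v N a) (h k) = herm_inner n (v j) (h k)"
    if "j < K" "k < K" for j k
    using that w(3) step.prems[of k N] \<open>K \<le> N\<close> by (simp add: herm_inner_add_smult)
  ultimately show ?case
    using w(1,2) by (intro exI[of _ "\<lambda>j a. w j a + c j * v N a"]) simp
qed

section \<open>Traces and SINR in terms of single beams\<close>

lemma mat_trace_covariance:
  assumes Q: "Q \<in> carrier_mat n n" and V: "V \<in> carrier_mat n N"
  shows "mat_trace (Q * (V * mat_adjoint V)) =
    (\<Sum>j<N. sesq n (\<lambda>a b. Q $$ (a, b)) (\<lambda>a. V $$ (a, j)) (\<lambda>a. V $$ (a, j)))"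
proof -
  let ?W = "V * mat_adjoint V"
  have W: "?W \<in> carrier_mat n n"
    using V mat_adjoint_carrier[OF V] by simp
  have W_index: "?W $$ (b, a) = (\<Sum>j<N. V $$ (b, j) * cnj (V $$ (a, j)))"
    if "a < n" "b < n" for a b
    using that V mat_adjoint_carrier[OF V]
    by (simp add: scalar_prod_def mat_adjoint_index lessThan_atLeast0)
  have "(Q * X) $$ (a, a) = (\<Sum>b<n. Q $$ (a, b) * X $$ (b, a))"
    if "X \<in> carrier_mat n n" "a < n" for X a
    using that Q by (simp add: scalar_prod_def lessThan_atLeast0)
  from this[OF W] have "mat_trace (Q * ?W) =
      (\<Sum>a<n. \<Sum>b<n. Q $$ (a, b) * (\<Sum>j<N. V $$ (b, j) * cnj (V $$ (a, j))))"
    unfolding mat_trace_def using Q by (intro sum.cong) (simp_all add: W_index del: index_mult_mat(1))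
  then show ?thesis by (simp only: sum_sesq_gram)
qed

lemma col_cscalar_prod:
  assumes "V \<in> carrier_mat n N" "h \<in> carrier_vec n" "j < N"
  shows "col V j \<bullet>c h = herm_inner n (\<lambda>a. V $$ (a, j)) (vec_index h)"
  using assms by (simp add: scalar_prod_def herm_inner_def lessThan_atLeast0)

text \<open>Without cancellation, sensing beams interfere just like foreign communication beams, so
  the interference is the total received power minus the useful power. For a fixed total, the SINR
  grows with \<open>g k\<close>.\<close>

lemma SINR_NIC_eq:
  assumes V: "V \<in> carrier_mat n N" and h: "hc k \<in> carrier_vec n" and "k < K" "K \<le> N"
    and g: "g = (\<lambda>j. (cmod (herm_inner n (\<lambda>a. V $$ (a, j)) (vec_index (hc k))))\<^sup>2)"
  shows "SINR_NIC K \<sigma>2 hc V k = g k / ((\<Sum>j<N. g j) - g k + \<sigma>2)"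
proof -
  have col: "(cmod (col V j \<bullet>c hc k))\<^sup>2 = g j" if "j < N" for j
    using col_cscalar_prod[OF V h that] by (simp add: g)
  have "(\<Sum>j\<in>{..<K} - {k}. g j) + (\<Sum>j = K..<N. g j) = (\<Sum>j<N. g j) - g k"
    using \<open>k < K\<close> \<open>K \<le> N\<close> sum.atLeastLessThan_concat[of 0 K N g]
    by (simp add: sum_diff1 lessThan_atLeast0)
  moreover have "(\<Sum>j\<in>{..<K} - {k}. (cmod (col V j \<bullet>c hc k))\<^sup>2) = (\<Sum>j\<in>{..<K} - {k}. g j)"
    using \<open>K \<le> N\<close> by (intro sum.cong refl col) auto
  moreover have "(\<Sum>j = K..<N. (cmod (col V j \<bullet>c hc k))\<^sup>2) = (\<Sum>j = K..<N. g j)"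
    by (intro sum.cong refl col) auto
  ultimately show ?thesis
    using \<open>k < K\<close> \<open>K \<le> N\<close>
    by (simp add: SINR_NIC_def sensing_quadratic_form[OF V h \<open>K \<le> N\<close>] col del: of_real_sum)
qed

section \<open>Beamforming with exactly \<open>K\<close> beams\<close>

theorem corollary4:
  fixes NT d K :: nat
    and \<sigma>2 P :: real
    and hc :: "nat \<Rightarrow> complex vec"
    and h_d :: "complex mat \<Rightarrow> real"
  assumes "NT \<ge> 1" and "d \<ge> 1"
    and "\<sigma>2 > 0" and "P > 0"
    and "\<And>k. k < K \<Longrightarrow> hc k \<in> carrier_vec NT"
    and "d_quadratic NT K d h_d"
    and "real K \<ge> real d / 2"
  shows "\<forall>(h, \<gamma>) \<in> A_NIC NT K \<sigma>2 P hc h_d.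
           (\<forall>k < K. \<gamma> $ k > 0) \<longrightarrow>
           (\<exists>V' \<in> carrier_mat NT K.
              h_d V' = h \<and>
              (\<forall>k < K. vSINR_NIC K \<sigma>2 hc V' $ k \<ge> \<gamma> $ k) \<and>
              Re (mat_trace (V' * mat_adjoint V')) \<le> P)"
proof -
  obtain Q f where
    Q: "\<And>i. i < d \<Longrightarrow> Q i \<in> carrier_mat NT NT" "\<And>i. i < d \<Longrightarrow> hermitian_mat (Q i)"
    and h_d: "\<And>N V. N \<ge> K \<Longrightarrow> V \<in> carrier_mat NT N \<Longrightarrow>
      h_d V = f (vec d (\<lambda>i. Re (mat_trace (Q i * (V * mat_adjoint V)))))"
    using assms(6) unfolding d_quadratic_def by metis
  \<comment> \<open>Index \<open>d\<close> holds the identity, whose form is the transmit power;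
    this is the form that \<open>absorb_beams\<close> keeps from growing.\<close>
  define R where "R i = (if i < d then Q i else 1\<^sub>m NT)" for i
  have R: "R i \<in> carrier_mat NT NT" for i using Q by (auto simp: R_def)
  have herm: "R i $$ (b, a) = cnj (R i $$ (a, b))" if "i \<le> d" "a < NT" "b < NT" for i a b
  proof (cases "i < d")
    case True
    then have "Q i $$ (b, a) = mat_adjoint (Q i) $$ (b, a)"
      using Q(2) by (simp add: hermitian_mat_def)
    then show ?thesis using True Q(1)[OF True] that by (simp add: R_def mat_adjoint_index)
  qed (use that in \<open>auto simp: R_def\<close>)
  have nonneg: "Re (sesq NT (\<lambda>a b. R d $$ (a, b)) x x) \<ge> 0" for x
  proof -
    have "sesq NT (\<lambda>a b. R d $$ (a, b)) x x = (\<Sum>a<NT. x a * cnj (x a))"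
      unfolding sesq_def R_def by (intro sum.cong refl) (simp add: if_distrib if_distribR sum.delta' cong: if_cong)
    then show ?thesis by (simp add: sum_nonneg flip: complex_norm_square)
  qed
  have trace: "Re (mat_trace (R i * (V * mat_adjoint V))) =
      (\<Sum>j<N. Re (sesq NT (\<lambda>a b. R i $$ (a, b)) (\<lambda>a. V $$ (a, j)) (\<lambda>a. V $$ (a, j))))"
    if "V \<in> carrier_mat NT N" for i V N
    using mat_trace_covariance[OF R that] by simp
  have power: "R d * (V * mat_adjoint V) = V * mat_adjoint V" if "V \<in> carrier_mat NT N" for V N
    using that mat_adjoint_carrier[OF that] by (simp add: R_def)
  have "d \<le> 2 * K" using assms(7) by linarith
  define H where "H k = vec_index (hc k)" for k
  have "\<exists>V' \<in> carrier_mat NT K. h_d V' = h_d V \<and>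
      (\<forall>k < K. SINR_NIC K \<sigma>2 hc V' k \<ge> SINR_NIC K \<sigma>2 hc V k) \<and>
      Re (mat_trace (V' * mat_adjoint V')) \<le> P"
    if V: "V \<in> carrier_mat NT (NT + K)" and tr: "Re (mat_trace (V * mat_adjoint V)) \<le> P" for V
  proof -
    let ?N = "NT + K"
    define v where "v j a = V $$ (a, j)" for j a
    obtain w where
      gram: "\<And>a b. (\<Sum>j<?N. w j a * cnj (w j b)) = (\<Sum>j<?N. v j a * cnj (v j b))"
      and sig: "\<And>k. k < K \<Longrightarrow> cmod (herm_inner NT (v k) (H k)) \<le> cmod (herm_inner NT (w k) (H k))"
      and orth: "\<And>k s. k < K \<Longrightarrow> K \<le> s \<Longrightarrow> s < ?N \<Longrightarrow> herm_inner NT (w s) (H k) = 0"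
      using align_beams[of K ?N v NT H] by auto
    have sesq_w: "(\<Sum>j<?N. Re (sesq NT S (w j) (w j))) = (\<Sum>j<?N. Re (sesq NT S (v j) (v j)))" for S
      by (simp only: sum_sesq_gram gram flip: Re_sum)
    obtain u where
      u: "\<And>i. i < d \<Longrightarrow> (\<Sum>j<K. Re (sesq NT (\<lambda>a b. R i $$ (a, b)) (u j) (u j))) =
            (\<Sum>j<?N. Re (sesq NT (\<lambda>a b. R i $$ (a, b)) (w j) (w j)))"
        "(\<Sum>j<K. Re (sesq NT (\<lambda>a b. R d $$ (a, b)) (u j) (u j))) \<le>
            (\<Sum>j<?N. Re (sesq NT (\<lambda>a b. R d $$ (a, b)) (w j) (w j)))"
        "\<And>j k. j < K \<Longrightarrow> k < K \<Longrightarrow> herm_inner NT (u j) (H k) = herm_inner NT (w j) (H k)"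
      using absorb_beams[where n = NT and d = d and Q = "\<lambda>i a b. R i $$ (a, b)" and K = K
        and N = ?N and v = w and h = H, OF herm \<open>d \<le> 2 * K\<close> nonneg le_add2 orth] by blast
    define V' where "V' = mat NT K (\<lambda>(a, j). u j a)"
    have V': "V' \<in> carrier_mat NT K" by (simp add: V'_def)
    have sesq_V': "sesq NT S (\<lambda>a. V' $$ (a, j)) (\<lambda>a. V' $$ (a, j)) = sesq NT S (u j) (u j)"
      if "j < K" for S j
      using that by (simp add: sesq_def V'_def)
    have inner_V': "herm_inner NT (\<lambda>a. V' $$ (a, j)) y = herm_inner NT (u j) y" if "j < K" for j y
      using that by (simp add: herm_inner_def V'_def)
    have "Re (mat_trace (Q i * (V' * mat_adjoint V'))) = Re (mat_trace (Q i * (V * mat_adjoint V)))"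
      if "i < d" for i
      using that trace[OF V', of i] trace[OF V, of i] u(1)[OF that]
      by (simp add: sesq_V' sesq_w v_def[abs_def] R_def)
    then have "vec d (\<lambda>i. Re (mat_trace (Q i * (V' * mat_adjoint V')))) =
               vec d (\<lambda>i. Re (mat_trace (Q i * (V * mat_adjoint V))))"
      by (intro eq_vecI) auto
    then have "h_d V' = h_d V" using h_d[OF _ V'] h_d[OF _ V] by simp
    moreover have "Re (mat_trace (V' * mat_adjoint V')) \<le> P"
      using trace[OF V', of d] trace[OF V, of d] power[OF V'] power[OF V] u(2) tr
      by (simp add: sesq_V' sesq_w v_def[abs_def])
    moreover have "SINR_NIC K \<sigma>2 hc V' k \<ge> SINR_NIC K \<sigma>2 hc V k" if k: "k < K" for k
    proof -
      define p where "p j = (cmod (herm_inner NT (v j) (H k)))\<^sup>2" for j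
      define q where "q j = (cmod (herm_inner NT (\<lambda>a. V' $$ (a, j)) (H k)))\<^sup>2" for j
      have q: "q j = (cmod (herm_inner NT (w j) (H k)))\<^sup>2" if "j < K" for j
        using that k by (simp add: q_def inner_V' u(3))
      \<comment> \<open>Alignment preserved the covariance and hence the total power received by
        user \<open>k\<close>. The sensing beams of \<open>w\<close> contribute nothing to it, so
        the \<open>K\<close> remaining beams carry all of it.\<close>
      have "of_real (\<Sum>j<?N. (cmod (herm_inner NT (w j) (H k)))\<^sup>2) = (of_real (\<Sum>j<?N. p j) :: complex)"
        unfolding p_def sum_norm_herm_inner_gram gram ..
      then have "(\<Sum>j<?N. p j) = (\<Sum>j<?N. (cmod (herm_inner NT (w j) (H k)))\<^sup>2)"
        by (simp only: of_real_eq_iff)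
      also have "\<dots> = (\<Sum>j<K. q j)"
        using orth[OF k] by (intro sum.mono_neutral_cong_right) (auto simp: q)
      finally have total: "(\<Sum>j<?N. p j) = (\<Sum>j<K. q j)" .
      have "p k \<le> q k" using sig[OF k] k by (simp add: p_def q power_mono)
      moreover have "q k \<le> (\<Sum>j<K. q j)"
        using k by (intro member_le_sum) (auto simp: q_def)
      \<comment> \<open>The total is the same on both sides: a larger useful power raises the
        numerator and lowers the denominator, which stays positive thanks to
        \<open>\<sigma>2\<close>.\<close>
      ultimately have "p k / ((\<Sum>j<?N. p j) - p k + \<sigma>2) \<le> q k / ((\<Sum>j<K. q j) - q k + \<sigma>2)"
        using \<open>\<sigma>2 > 0\<close> by (intro frac_le) (auto simp: total q_def)
      moreover have "SINR_NIC K \<sigma>2 hc V k = p k / ((\<Sum>j<?N. p j) - p k + \<sigma>2)"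
        by (rule SINR_NIC_eq[where g = p and hc = hc and k = k, OF V assms(5)[OF k] k])
          (auto simp: p_def v_def[abs_def] H_def)
      moreover have "SINR_NIC K \<sigma>2 hc V' k = q k / ((\<Sum>j<K. q j) - q k + \<sigma>2)"
        by (rule SINR_NIC_eq[where g = q and hc = hc and k = k, OF V' assms(5)[OF k] k])
          (auto simp: q_def H_def)
      ultimately show ?thesis by simp
    qed
    ultimately show ?thesis using V' by blast
  qed
  then show ?thesis unfolding A_NIC_def vSINR_NIC_def by fastforce
qed

end
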